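(* Let $N\ge 2$, let $0<s<1<p<\frac{N}{s}$, and let $\Omega\subset\mathbb{R}^N$ be a ball. Then the $(s,p)$-torsion function $\phi_p^s$ of $\Omega$ is radial (with respect to the center of the ball).
   Context: For a measurable function $u:\mathbb{R}^N\to\mathbb{R}$, $[u]_{s,p}:=\left(\int_{\mathbb{R}^N}\int_{\mathbb{R}^N}\frac{|u(x)-u(y)|^p}{|x-y|^{N+sp}}\,dx\,dy\right)^{1/p}$. The space $W_0^{s,p}(\Omega)$ is the closure of $C_0^\infty(\Omega)$ with respect to the norm $\|u\|:=[u]_{s,p}+\|u\|_{L^p(\Omega)}$; its elements are regarded as functions on $\mathbb{R}^N$ vanishing in $\mathbb{R}^N\setminus\Omega$. For $u,\varphi\in W_0^{s,p}(\Omega)$ put $$\langle(-\Delta)_p^s u,\varphi\rangle:=\int_{\mathbb{R}^N}\int_{\mathbb{R}^N}\frac{|u(x)-u(y)|^{p-2}(u(x)-u(y))(\varphi(x)-\varphi(y))}{|x-y|^{N+sp}}\,dx\,dy .$$ The $(s,p)$-torsion function $\phi_p^s$ of $\Omega$ is the unique function in $W_0^{s,p}(\Omega)$ with $\langle(-\Delta)_p^s\phi_p^s,\varphi\rangle=\int_\Omega\varphi\,dx$ for all $\varphi\in W_0^{s,p}(\Omega)$. A function is radial if it agrees a.e. with a function of the distance to the center of the ball only. *)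

theory Defs
  imports "HOL-Analysis.Analysis"
begin

(* The p-th root on [0, \<infinity>]; it keeps norms of functions of infinite energy infinite. *)
definition ennroot :: "real \<Rightarrow> ennreal \<Rightarrow> ennreal" where
  "ennroot p t = (if t = \<infinity> then \<infinity> else ennreal (enn2real t powr (1 / p)))"

(* The kernels below are 0 on the diagonal x = y, since 0 / 0 = 0; the diagonal is a null set. *)
definition gagliardo_seminorm :: "real \<Rightarrow> real \<Rightarrow> ('a::euclidean_space \<Rightarrow> real) \<Rightarrow> ennreal" where
  "gagliardo_seminorm s p u =
     ennroot p (\<integral>\<^sup>+ y. (\<integral>\<^sup>+ x.
       ennreal (\<bar>u x - u y\<bar> powr p / norm (x - y) powr (real DIM('a) + s * p)) \<partial>lebesgue) \<partial>lebesgue)"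

definition Lp_norm :: "real \<Rightarrow> 'a::euclidean_space set \<Rightarrow> ('a \<Rightarrow> real) \<Rightarrow> ennreal" where
  "Lp_norm p \<Omega> u = ennroot p (\<integral>\<^sup>+ x \<in> \<Omega>. ennreal (\<bar>u x\<bar> powr p) \<partial>lebesgue)"

definition frac_norm ::
    "real \<Rightarrow> real \<Rightarrow> 'a::euclidean_space set \<Rightarrow> ('a \<Rightarrow> real) \<Rightarrow> ennreal" where
  "frac_norm s p \<Omega> u = gagliardo_seminorm s p u + Lp_norm p \<Omega> u"

primrec C_diff :: "nat \<Rightarrow> ('a::euclidean_space \<Rightarrow> real) \<Rightarrow> bool" where
  "C_diff 0 f \<longleftrightarrow> continuous_on UNIV f"
| "C_diff (Suc k) f \<longleftrightarrow>
     (\<forall>x. f differentiable (at x)) \<and> (\<forall>b\<in>Basis. C_diff k (\<lambda>x. frechet_derivative f (at x) b))"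

definition test_functions :: "'a::euclidean_space set \<Rightarrow> ('a \<Rightarrow> real) set" where
  "test_functions \<Omega> =
     {\<psi>. (\<forall>k. C_diff k \<psi>) \<and> compact (closure {x. \<psi> x \<noteq> 0}) \<and> closure {x. \<psi> x \<noteq> 0} \<subseteq> \<Omega>}"

(* Elements are representatives of a.e. classes, so they vanish outside \<Omega> only almost everywhere. *)
definition W0 :: "real \<Rightarrow> real \<Rightarrow> 'a::euclidean_space set \<Rightarrow> ('a \<Rightarrow> real) set" where
  "W0 s p \<Omega> =
     {u \<in> borel_measurable lebesgue.
        (AE x in lebesgue. x \<notin> \<Omega> \<longrightarrow> u x = 0) \<and>
        frac_norm s p \<Omega> u < \<infinity> \<and>
        (\<forall>\<epsilon>::real. \<epsilon> > 0 \<longrightarrow>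
           (\<exists>\<psi>\<in>test_functions \<Omega>. frac_norm s p \<Omega> (\<lambda>x. u x - \<psi> x) < ennreal \<epsilon>))}"

(* For u and \<phi> in W0 s p \<Omega> with 1 < p the double integral converges absolutely, by Hoelder's
   inequality.  For p < 2 the expression |t| powr (p - 2) * t is 0 at t = 0, as intended. *)
definition frac_p_laplacian ::
    "real \<Rightarrow> real \<Rightarrow> ('a::euclidean_space \<Rightarrow> real) \<Rightarrow> ('a \<Rightarrow> real) \<Rightarrow> real" where
  "frac_p_laplacian s p u \<phi> =
     (LINT y|lebesgue. (LINT x|lebesgue.
        \<bar>u x - u y\<bar> powr (p - 2) * (u x - u y) * (\<phi> x - \<phi> y) / norm (x - y) powr (real DIM('a) + s * p)))"

(* The torsion function is determined only up to null sets; this predicate holds of each of its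
   representatives. *)
definition is_torsion_function ::
    "real \<Rightarrow> real \<Rightarrow> 'a::euclidean_space set \<Rightarrow> ('a \<Rightarrow> real) \<Rightarrow> bool" where
  "is_torsion_function s p \<Omega> u \<longleftrightarrow>
     u \<in> W0 s p \<Omega> \<and>
     (\<forall>\<phi> \<in> W0 s p \<Omega>. frac_p_laplacian s p u \<phi> = (LINT x:\<Omega>|lebesgue. \<phi> x))"

definition radial_about :: "'a::euclidean_space \<Rightarrow> ('a \<Rightarrow> real) \<Rightarrow> bool" where
  "radial_about c u \<longleftrightarrow> (\<exists>g :: real \<Rightarrow> real. AE x in lebesgue. u x = g (dist c x))"

end

theory Submission
  imports Defs
begin

text \<open>
  The equation is invariant under isometries and its solution is unique, so the solution is
  invariant under all isometries that fix the ball; what remains is to pass from almost everywhere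
  invariance under each isometry to radial symmetry.

  It is enough to use the reflections in the hyperplanes through the center \<open>c\<close>.  A reflection
  preserves distances and Lebesgue measure (\<open>distr_lborel_orthogonal_transformation\<close>),
  hence the kernel of the operator, the norms and the space \<open>W0\<close>; so \<open>\<phi>\<close> composed with it is
  again a torsion function (\<open>is_torsion_function_compose\<close>).

  Two torsion functions \<open>u\<close>, \<open>v\<close> agree almost everywhere (\<open>torsion_function_unique\<close>): testing both
  equations with \<open>w = u - v\<close> and subtracting gives a double integral whose integrand is nonnegative,
  because \<open>t \<mapsto> \<bar>t\<bar>\<^sup>p\<^sup>-\<^sup>2 t\<close> is strictly increasing, and vanishes only where \<open>w x = w y\<close>.  So \<open>w\<close> is
  constant almost everywhere, and the constant is 0 since \<open>w\<close> vanishes off the ball.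

  Hence for every normal vector \<open>v\<close> the function \<open>\<phi>\<close> equals its reflection off a null set that may
  depend on \<open>v\<close>.  By Fubini, almost every point \<open>x\<close> is good: \<open>\<phi>\<close> takes the value \<open>\<phi> x\<close> at the mirror
  image of \<open>x\<close> for almost every \<open>v\<close>.  If \<open>x\<close> and \<open>y\<close> are good and equidistant from \<open>c\<close>, then some
  point is a mirror image of both under normals outside the two exceptional sets, and therefore
  \<open>\<phi> x = \<phi> y\<close> (\<open>eq_if_AE_reflect_eq\<close>).
\<close>

section \<open>Linear isometries preserve Lebesgue measure\<close>

lemma distr_lborel_translate_reflect:
  fixes a :: "'a::euclidean_space" and \<sigma> :: real
  assumes "\<bar>\<sigma>\<bar> = 1"
  shows "distr lborel borel (\<lambda>x. a + \<sigma> *\<^sub>R x) = lborel"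
proof -
  have "\<sigma> \<noteq> 0"
    using assms by auto
  from lborel_affine[OF this, of a] show ?thesis
    using assms by (simp add: density_1)
qed

lemma nn_integral_lborel_translate_reflect:
  fixes a :: "'a::euclidean_space" and \<sigma> :: real
  assumes [measurable]: "f \<in> borel_measurable borel" and "\<bar>\<sigma>\<bar> = 1"
  shows "(\<integral>\<^sup>+ x. f (a + \<sigma> *\<^sub>R x) \<partial>lborel) = (\<integral>\<^sup>+ x. f x \<partial>lborel)"
proof -
  have "(\<integral>\<^sup>+ x. f x \<partial>lborel) = (\<integral>\<^sup>+ x. f x \<partial>distr lborel borel (\<lambda>x. a + \<sigma> *\<^sub>R x))"
    using distr_lborel_translate_reflect[OF assms(2), of a] by simp
  also have "\<dots> = (\<integral>\<^sup>+ x. f (a + \<sigma> *\<^sub>R x) \<partial>lborel)"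
    by (subst nn_integral_distr) auto
  finally show ?thesis ..
qed

text \<open>
  This is the usual proof that a translation invariant measure is unique up to a factor.
  For Borel \<open>B\<close> and the unit ball \<open>A\<close>, translations inside a double integral turn
  \<open>\<lambda>(L\<^sup>-\<^sup>1 B) \<lambda>(A)\<close> into \<open>\<lambda>(B) \<lambda>(L\<^sup>-\<^sup>1 A)\<close>, where \<open>\<lambda>\<close> is Lebesgue measure.  As \<open>L\<close> maps the unit ball
  onto itself, the finite positive factor \<open>\<lambda>(A)\<close> cancels.
\<close>

lemma distr_lborel_orthogonal_transformation:
  fixes L :: "'a::euclidean_space \<Rightarrow> 'a"
  assumes L: "orthogonal_transformation L"
  shows "distr lborel borel L = lborel"
proof (rule measure_eqI)
  fix B assume "B \<in> sets (distr lborel borel L)"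
  then have B[measurable]: "B \<in> sets borel" by simp
  have lin: "linear L"
    using L by (rule orthogonal_transformation_linear)
  then have contL: "continuous_on UNIV L"
    by (simp add: linear_continuous_on linear_linear)
  then have [measurable]: "L \<in> borel_measurable borel"
    by (rule borel_measurable_continuous_onI)
  define A :: "'a set" where "A = ball 0 1"
  have [measurable]: "A \<in> sets borel"
    by (simp add: A_def)
  have LA: "L x \<in> A \<longleftrightarrow> x \<in> A" for x
    using L by (simp add: A_def dist_norm orthogonal_transformation_norm)
  define M where "M = inv L"
  have LM: "L (M y) = y" for y
    using orthogonal_transformation_surj[OF L] by (simp add: M_def surj_f_inv_f)
  have "emeasure lborel (L -` B) * emeasure lborel A
      = (\<integral>\<^sup>+ x. \<integral>\<^sup>+ y. indicator B (L x) * indicator A y \<partial>lborel \<partial>lborel)"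
  proof -
    have "(\<integral>\<^sup>+ x. indicator B (L x) \<partial>lborel) = emeasure lborel (L -` B)"
      using measurable_sets_borel[of L borel B]
      by (simp flip: nn_integral_indicator add: indicator_vimage)
    then show ?thesis
      by (simp add: nn_integral_cmult nn_integral_multc)
  qed
  also have "\<dots> = (\<integral>\<^sup>+ x. \<integral>\<^sup>+ y. indicator B (L x) * indicator A (L x + 1 *\<^sub>R y) \<partial>lborel \<partial>lborel)"
    by (subst nn_integral_lborel_translate_reflect[where f="\<lambda>y. indicator B (L x) * indicator A y" for x]) auto
  also have "\<dots> = (\<integral>\<^sup>+ y. \<integral>\<^sup>+ x. indicator B (L x) * indicator A (L x + 1 *\<^sub>R y) \<partial>lborel \<partial>lborel)"
    by (subst lborel_pair.Fubini') auto
  also have "\<dots> = (\<integral>\<^sup>+ y. \<integral>\<^sup>+ x. indicator B (L (- M y + 1 *\<^sub>R x)) * indicator A (L (- M y + 1 *\<^sub>R x) + 1 *\<^sub>R y)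
      \<partial>lborel \<partial>lborel)"
    by (subst nn_integral_lborel_translate_reflect
        [where f="\<lambda>x. indicator B (L x) * indicator A (L x + 1 *\<^sub>R y)" for y]) auto
  also have "\<dots> = (\<integral>\<^sup>+ y. \<integral>\<^sup>+ x. indicator B (L x - y) * indicator A (L x) \<partial>lborel \<partial>lborel)"
    by (simp add: linear_diff[OF lin] LM)
  also have "\<dots> = (\<integral>\<^sup>+ x. \<integral>\<^sup>+ y. indicator B (L x + (-1) *\<^sub>R y) * indicator A x \<partial>lborel \<partial>lborel)"
    by (subst lborel_pair.Fubini') (auto simp: LA indicator_def)
  also have "\<dots> = (\<integral>\<^sup>+ x. \<integral>\<^sup>+ y. indicator B y * indicator A x \<partial>lborel \<partial>lborel)"
    by (subst nn_integral_lborel_translate_reflect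
        [where f="\<lambda>y. indicator B y * indicator A x" for x]) auto
  also have "\<dots> = emeasure lborel B * emeasure lborel A"
    by (simp add: nn_integral_cmult nn_integral_multc)
  finally have eq: "emeasure lborel (L -` B) * emeasure lborel A = emeasure lborel B * emeasure lborel A" .
  have "emeasure lborel A \<noteq> 0"
    using emeasure_lborel_ball_finite open_not_negligible[of A]
    by (auto simp: A_def negligible_iff_emeasure0)
  moreover have "emeasure lborel A \<noteq> \<infinity>"
    using emeasure_lborel_ball_finite[of 0 1] by (auto simp: A_def less_top)
  ultimately have "emeasure lborel (L -` B) = emeasure lborel B"
    using eq by (simp add: ennreal_mult_cancel_left mult.commute[of _ "emeasure lborel A"])
  then show "emeasure (distr lborel borel L) B = emeasure lborel B"
    by (simp add: emeasure_distr)
qed simp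

lemma distr_lebesgue_if_distr_lborel:
  assumes [measurable]: "T \<in> borel_measurable borel" and d: "distr lborel borel T = lborel"
  shows "T \<in> lebesgue \<rightarrow>\<^sub>M lebesgue" "distr lebesgue lebesgue T = lebesgue"
proof -
  have T: "T \<in> borel_measurable lebesgue"
    by (simp add: measurable_completion)
  have eq: "distr lebesgue lborel T = lborel"
    using d by (simp add: distr_completion cong: distr_cong)
  show meas: "T \<in> lebesgue \<rightarrow>\<^sub>M lebesgue"
    by (rule completion.measurable_completion2) (auto simp: eq T)
  show "distr lebesgue lebesgue T = lebesgue"
    by (subst completion.completion_distr_eq[symmetric]) (auto simp: eq T)
qed

section \<open>Hyperplane reflections\<close>

text \<open>
  The reflection in the hyperplane through \<open>c\<close> with normal \<open>v\<close>.  As division by zero yields zero,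
  it is the identity for \<open>v = 0\<close>, so every \<open>v\<close> gives an isometry.
\<close>

definition reflect :: "'a::euclidean_space \<Rightarrow> 'a \<Rightarrow> 'a \<Rightarrow> 'a" where
  "reflect c v x = x - (2 * (v \<bullet> (x - c)) / (v \<bullet> v)) *\<^sub>R v"

lemma linear_reflect_0: "linear (reflect 0 v)"
  by (rule linearI) (auto simp: reflect_def inner_add_right algebra_simps add_divide_distrib)

lemma reflect_conv: "reflect c v x = c + reflect 0 v (x - c)"
  by (simp add: reflect_def)

lemma orthogonal_transformation_reflect: "orthogonal_transformation (reflect 0 v)"
proof (cases "v = 0")
  case False
  have "reflect 0 v x \<bullet> reflect 0 v y = x \<bullet> y" for x y
    using False
    by (simp add: reflect_def inner_diff_left inner_diff_right inner_commute field_simps)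
  then show ?thesis
    by (simp add: orthogonal_transformation_def linear_reflect_0)
qed (simp add: reflect_def[abs_def] orthogonal_transformation_def linear_id[unfolded id_def])

lemma dist_reflect: "dist (reflect c v x) (reflect c v y) = dist x y"
proof -
  have "dist (reflect 0 v (x - c)) (reflect 0 v (y - c)) = dist (x - c) (y - c)"
    using orthogonal_transformation_reflect[of v]
    unfolding orthogonal_transformation_isometry by blast
  then show ?thesis
    by (simp add: reflect_conv[of c] dist_norm)
qed

lemma reflect_center [simp]: "reflect c v c = c"
  by (simp add: reflect_def)

lemma reflect_reflect [simp]: "reflect c v (reflect c v x) = x"
proof (cases "v = 0")
  case False
  have "v \<bullet> (reflect c v x - c) = - (v \<bullet> (x - c))"
    using False by (simp add: reflect_def inner_diff_right)
  then show ?thesis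
    unfolding reflect_def[of c v "reflect c v x"] by (simp add: reflect_def)
qed (simp add: reflect_def)

lemma reflect_scaleR: "k \<noteq> 0 \<Longrightarrow> reflect c (k *\<^sub>R v) x = reflect c v x"
  by (simp add: reflect_def)

lemma measurable_reflect [measurable]: "reflect c v \<in> borel_measurable borel"
  unfolding reflect_def by measurable

lemma distr_lborel_reflect: "distr lborel borel (reflect c v) = lborel"
proof -
  have [measurable]: "reflect 0 v \<in> borel_measurable borel" by simp
  have 1: "distr lborel borel (\<lambda>x. k + x) = lborel" for k :: 'a
    using lborel_distr_plus[of k] by simp
  have "lborel = distr (distr (distr lborel borel (\<lambda>x. - c + x)) borel (reflect 0 v)) borel (\<lambda>x. c + x)"
    by (simp only: 1 distr_lborel_orthogonal_transformation orthogonal_transformation_reflect)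
  also have "\<dots> = distr lborel borel (reflect c v)"
    by (simp add: distr_distr o_def reflect_conv[of c v] cong: distr_cong)
  finally show ?thesis ..
qed

lemmas measurable_lebesgue_reflect = distr_lebesgue_if_distr_lborel(1)[OF measurable_reflect distr_lborel_reflect]
lemmas distr_lebesgue_reflect = distr_lebesgue_if_distr_lborel(2)[OF measurable_reflect distr_lborel_reflect]

section \<open>Invariance under every reflection implies radial symmetry\<close>

text \<open>
  Put \<open>c = 0\<close> and let \<open>w\<close> be the image of \<open>x\<close> under the reflection with normal \<open>v\<close>.  If \<open>w \<noteq> y\<close>, the
  reflection with normal \<open>u = y - w\<close> maps \<open>y\<close> to \<open>w\<close> as well, so \<open>f x = f w = f y\<close> unless \<open>v\<close> is
  exceptional for \<open>x\<close> or \<open>u\<close> is exceptional for \<open>y\<close>.  The vector \<open>v\<close> is recovered from \<open>u\<close>, up to a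
  factor, by the polynomial map \<open>\<Psi>\<close>, and differentiable maps send null sets to null sets;
  the vectors \<open>v\<close> for which \<open>u\<close> is exceptional therefore form a null set too.
\<close>

lemma eq_if_AE_reflect_eq:
  fixes c :: "'a::euclidean_space" and f :: "'a \<Rightarrow> 'b"
  assumes x: "AE v in lebesgue. f (reflect c v x) = f x"
    and y: "AE v in lebesgue. f (reflect c v y) = f y"
    and d: "dist c x = dist c y"
  shows "f x = f y"
proof (cases "x = c")
  case True
  then show ?thesis using d by simp
next
  case False
  define a where "a = x - c"
  define b where "b = y - c"
  have "a \<noteq> 0" using False by (simp add: a_def)
  have ab: "a \<bullet> a = b \<bullet> b"
    using d by (simp add: a_def b_def dist_norm norm_minus_commute dot_square_norm)
  define N where "N z = {v. f (reflect c v z) \<noteq> f z}" for z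
  have N: "negligible (N x)" "negligible (N y)"
    using x y negligible_subset unfolding N_def eventually_ae_filter_negligible by blast+
  define \<Psi> where "\<Psi> u = (u \<bullet> u) *\<^sub>R (a - b) + (2 * (u \<bullet> b)) *\<^sub>R u" for u
  \<comment> \<open>Exceptional normals are closed under nonzero multiples, so in recovering \<open>v\<close> from its multiple
    \<open>\<Psi> u\<close> only the sign has to be taken care of.
    Normals orthogonal to \<open>a\<close> are left out below because for them the multiple is 0.\<close>
  have diff: "\<Psi> differentiable_on S" "(\<lambda>u. - \<Psi> u) differentiable_on S" for S
    unfolding \<Psi>_def differentiable_on_def by (auto intro!: derivative_intros)
  have "negligible (N x \<union> {v. a \<bullet> v = 0} \<union> \<Psi> ` N y \<union> (\<lambda>u. - \<Psi> u) ` N y)"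
    using N \<open>a \<noteq> 0\<close> diff
    by (intro negligible_Un negligible_hyperplane negligible_differentiable_image_negligible) auto
  then obtain v where v: "v \<notin> N x" "a \<bullet> v \<noteq> 0" "v \<notin> \<Psi> ` N y" "v \<notin> (\<lambda>u. - \<Psi> u) ` N y"
    using non_negligible_UNIV by (metis (mono_tags, lifting) UNIV_eq_I UnCI mem_Collect_eq)
  define w where "w = reflect c v x - c"
  have w: "w = a - (2 * (v \<bullet> a) / (v \<bullet> v)) *\<^sub>R v"
    by (simp add: w_def a_def reflect_def)
  have "v \<noteq> 0" using v(2) by auto
  have fw: "f (c + w) = f x"
    using v(1) by (simp add: N_def w_def)
  have ww: "w \<bullet> w = b \<bullet> b"
    unfolding ab[symmetric] w using \<open>v \<noteq> 0\<close>
    by (simp add: inner_diff_left inner_diff_right inner_commute field_simps)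
  show ?thesis
  proof (cases "w = b")
    case True
    then show ?thesis using fw by (simp add: b_def)
  next
    case False
    define u where "u = b - w"
    have "u \<noteq> 0" using False by (simp add: u_def)
    have uu: "u \<bullet> u = 2 * (u \<bullet> b)"
      using ww by (simp add: u_def inner_diff_left inner_diff_right inner_commute)
    define k where "k = (u \<bullet> u) * (2 * (v \<bullet> a) / (v \<bullet> v))"
    have "k \<noteq> 0"
      using \<open>u \<noteq> 0\<close> \<open>v \<noteq> 0\<close> v(2) by (simp add: k_def inner_commute)
    have "\<Psi> u = (u \<bullet> u) *\<^sub>R (a - b + u)"
      unfolding \<Psi>_def uu[symmetric] by (simp add: scaleR_add_right)
    also have "a - b + u = (2 * (v \<bullet> a) / (v \<bullet> v)) *\<^sub>R v"
      by (simp add: u_def w)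
    finally have \<Psi>u: "\<Psi> u = k *\<^sub>R v"
      by (simp add: k_def)
    \<comment> \<open>\<open>\<Psi>\<close> is homogeneous of degree 2, so this factor normalizes \<open>k\<close> to \<open>1\<close> or \<open>-1\<close>.\<close>
    define t where "t = 1 / sqrt \<bar>k\<bar>"
    have "t \<noteq> 0" "t * t = 1 / \<bar>k\<bar>"
      using \<open>k \<noteq> 0\<close> by (auto simp: t_def)
    have "\<Psi> (t *\<^sub>R u) = (t * t) *\<^sub>R \<Psi> u"
      by (simp add: \<Psi>_def scaleR_add_right mult_ac)
    also have "\<dots> = sgn k *\<^sub>R v"
      using \<open>k \<noteq> 0\<close> \<open>t * t = 1 / \<bar>k\<bar>\<close> by (simp add: \<Psi>u sgn_if)
    finally have "v = \<Psi> (t *\<^sub>R u) \<or> v = - \<Psi> (t *\<^sub>R u)"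
      using \<open>k \<noteq> 0\<close> by (auto simp: sgn_if split: if_splits)
    then have "t *\<^sub>R u \<notin> N y"
      using v(3,4) by auto
    then have "f (reflect c u y) = f y"
      using \<open>t \<noteq> 0\<close> by (simp add: N_def reflect_scaleR)
    moreover have "reflect c u y = c + w"
    proof -
      have "2 * (u \<bullet> (y - c)) / (u \<bullet> u) = 1"
        using uu \<open>u \<noteq> 0\<close> unfolding b_def by (metis divide_self inner_eq_zero_iff)
      then show ?thesis
        by (simp only: reflect_def) (simp add: u_def b_def)
    qed
    ultimately show ?thesis using fw by simp
  qed
qed

text \<open>
  Fubini exchanges the quantifiers ``for every normal'' and ``at almost every point''.  It needs joint
  measurability in the point and the normal, which is why \<open>f\<close> is first replaced by a Borel
  representative \<open>g\<close>.
\<close>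

lemma radial_if_AE_reflect_eq:
  fixes f :: "'a::euclidean_space \<Rightarrow> real"
  assumes f: "f \<in> borel_measurable lebesgue"
    and inv: "\<And>v. AE x in lebesgue. f (reflect c v x) = f x"
  shows "radial_about c f"
proof -
  obtain g where g[measurable]: "g \<in> borel_measurable borel" and fg: "AE x in lborel. f x = g x"
    using completion_ex_borel_measurable_real[OF f] by auto
  have ginv: "AE x in lborel. g (reflect c v x) = g x" for v
  proof -
    have "AE x in distr lborel borel (reflect c v). f x = g x"
      unfolding distr_lborel_reflect by (rule fg)
    then have "AE x in lborel. f (reflect c v x) = g (reflect c v x)"
      by (rule AE_distrD[rotated]) simp
    moreover have "AE x in lborel. f (reflect c v x) = f x"
      using inv[of v] by (simp add: AE_completion_iff)
    ultimately show ?thesis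
      using fg by eventually_elim simp
  qed
  have "AE x in lborel. AE v in lborel. g (reflect c v x) = g x"
  proof (subst lborel_pair.AE_commute)
    have [measurable]: "(\<lambda>z. reflect c (snd z) (fst z)) \<in> borel_measurable (lborel \<Otimes>\<^sub>M lborel)"
      unfolding reflect_def by measurable
    show "{z \<in> space (lborel \<Otimes>\<^sub>M lborel). g (reflect c (snd z) (fst z)) = g (fst z)}
        \<in> sets (lborel \<Otimes>\<^sub>M lborel)"
      by measurable
  qed (simp add: ginv)
  with fg have good: "AE x in lborel. f x = g x \<and> (AE v in lborel. g (reflect c v x) = g x)"
    by eventually_elim simp
  define G where "G = {x. f x = g x \<and> (AE v in lborel. g (reflect c v x) = g x)}"
  have eq: "f x = f y" if "x \<in> G" "y \<in> G" "dist c x = dist c y" for x y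
    using that eq_if_AE_reflect_eq[of g c x y] by (auto simp: G_def AE_completion)
  define h where "h \<rho> = f (SOME x. x \<in> G \<and> dist c x = \<rho>)" for \<rho>
  have "f x = h (dist c x)" if "x \<in> G" for x
  proof -
    have "(SOME y. y \<in> G \<and> dist c y = dist c x) \<in> G \<and>
        dist c (SOME y. y \<in> G \<and> dist c y = dist c x) = dist c x"
      by (rule someI[of _ x]) (simp add: that)
    then show ?thesis
      unfolding h_def by (metis eq[OF that])
  qed
  moreover have "AE x in lebesgue. x \<in> G"
    using AE_completion[OF good] by (simp add: G_def)
  ultimately show ?thesis
    unfolding radial_about_def by (intro exI[of _ h]) (rule eventually_mono)
qed

section \<open>Test functions\<close>

lemma C_diff_linear_combination:
  "C_diff k f \<Longrightarrow> C_diff k g \<Longrightarrow> C_diff k (\<lambda>x. a * f x + b * g x)"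
proof (induction k arbitrary: f g)
  case 0
  then show ?case by (auto intro!: continuous_intros)
next
  case (Suc k)
  have d: "((\<lambda>x. a * f x + b * g x) has_derivative
      (\<lambda>h. a * frechet_derivative f (at x) h + b * frechet_derivative g (at x) h)) (at x)" for x
    using Suc.prems by (auto intro!: derivative_eq_intros simp: frechet_derivative_works)
  have fd: "frechet_derivative (\<lambda>x. a * f x + b * g x) (at x) =
      (\<lambda>h. a * frechet_derivative f (at x) h + b * frechet_derivative g (at x) h)" for x
    using frechet_derivative_at[OF d] by simp
  show ?case
    using Suc d by (auto simp: fd intro: differentiableI)
qed

lemma C_diff_zero: "C_diff k (\<lambda>x. 0)"
  by (induction k) auto

lemma C_diff_sum:
  assumes "finite I" "\<And>i. i \<in> I \<Longrightarrow> C_diff k (f i)"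
  shows "C_diff k (\<lambda>x. \<Sum>i\<in>I. a i * f i x)"
  using assms
proof (induction I)
  case (insert i I)
  then show ?case
    using C_diff_linear_combination[of k "f i" "\<lambda>x. \<Sum>i\<in>I. a i * f i x" "a i" 1] by simp
qed (simp add: C_diff_zero)

text \<open>
  The derivative \<open>L\<close> does not depend on the point, so the partial derivatives of the composition are
  combinations, with constant coefficients, of partial derivatives of \<open>f\<close> composed with \<open>T\<close>; this
  closes the induction.
\<close>

lemma C_diff_compose_affine:
  assumes T: "\<And>x. (T has_derivative L) (at x)"
  shows "C_diff k f \<Longrightarrow> C_diff k (\<lambda>x. f (T x))"
proof (induction k arbitrary: f)
  case 0
  have "continuous_on UNIV T"
    using T by (meson continuous_at_imp_continuous_on has_derivative_continuous)
  with 0 show ?case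
    by (auto intro: continuous_on_compose2)
next
  case (Suc k)
  have d: "((\<lambda>x. f (T x)) has_derivative (\<lambda>h. frechet_derivative f (at (T x)) (L h))) (at x)" for x
    using Suc.prems by (intro has_derivative_compose[OF T]) (simp add: frechet_derivative_works)
  have "frechet_derivative (\<lambda>x. f (T x)) (at x) b =
      (\<Sum>e\<in>Basis. (L b \<bullet> e) * frechet_derivative f (at (T x)) e)" for x b
  proof -
    have "linear (frechet_derivative f (at (T x)))"
      using Suc.prems by (simp add: linear_frechet_derivative)
    then have "frechet_derivative f (at (T x)) (\<Sum>e\<in>Basis. (L b \<bullet> e) *\<^sub>R e) =
        (\<Sum>e\<in>Basis. (L b \<bullet> e) * frechet_derivative f (at (T x)) e)"
      by (simp add: linear_sum linear_scale)
    then show ?thesis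
      by (simp add: frechet_derivative_at[OF d, symmetric] euclidean_representation)
  qed
  moreover have "C_diff k (\<lambda>x. frechet_derivative f (at (T x)) e)" if "e \<in> Basis" for e
    using Suc.IH[of "\<lambda>x. frechet_derivative f (at x) e"] Suc.prems that by simp
  moreover have "(\<lambda>x. f (T x)) differentiable (at x)" for x
    using d unfolding differentiable_def by blast
  ultimately show ?case
    by (auto intro!: C_diff_sum)
qed

lemma test_functions_diff:
  assumes "\<psi> \<in> test_functions \<Omega>" "\<xi> \<in> test_functions \<Omega>"
  shows "(\<lambda>x. \<psi> x - \<xi> x) \<in> test_functions \<Omega>"
proof -
  define K where "K = closure {x. \<psi> x \<noteq> 0} \<union> closure {x. \<xi> x \<noteq> 0}"
  have K: "compact K" "K \<subseteq> \<Omega>"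
    using assms by (auto simp: test_functions_def K_def)
  have "{x. \<psi> x - \<xi> x \<noteq> 0} \<subseteq> K"
    using closure_subset[of "{x. \<psi> x \<noteq> 0}"] closure_subset[of "{x. \<xi> x \<noteq> 0}"]
    unfolding K_def by force
  then have sub: "closure {x. \<psi> x - \<xi> x \<noteq> 0} \<subseteq> K"
    using K by (simp add: closure_minimal compact_imp_closed)
  then have "compact (closure {x. \<psi> x - \<xi> x \<noteq> 0})"
    using compact_Int_closed[OF K(1) closed_closure] by (metis inf.absorb2)
  moreover have "C_diff k (\<lambda>x. \<psi> x - \<xi> x)" for k
    using C_diff_linear_combination[of k \<psi> \<xi> 1 "-1"] assms by (simp add: test_functions_def)
  ultimately show ?thesis
    using sub K unfolding test_functions_def by blast
qed

lemma test_functions_measurable: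
  assumes "\<psi> \<in> test_functions \<Omega>"
  shows "\<psi> \<in> borel_measurable lebesgue"
proof -
  have "C_diff 0 \<psi>"
    using assms unfolding test_functions_def by blast
  then show ?thesis
    by (auto intro!: measurable_completion borel_measurable_continuous_onI)
qed

section \<open>The energy space\<close>

interpretation lebesgue: sigma_finite_measure "lebesgue :: 'a::euclidean_space measure"
proof
  obtain A :: "'a set set" where "countable A" "A \<subseteq> sets lborel" "\<Union>A = space lborel"
      "\<forall>a\<in>A. emeasure lborel a \<noteq> \<infinity>"
    using lborel.sigma_finite_countable by blast
  then show "\<exists>A::'a set set. countable A \<and> A \<subseteq> sets lebesgue \<and> \<Union>A = space lebesgue \<and>
      (\<forall>a\<in>A. emeasure lebesgue a \<noteq> \<infinity>)"
    by (intro exI[of _ A]) auto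
qed

interpretation lebesgue_pair: pair_sigma_finite
  "lebesgue :: 'a::euclidean_space measure" "lebesgue :: 'a measure" ..

text \<open>
  The integrals of \<open>frac_norm\<close> without the roots.  Smallness in either sense is the same, and here the
  triangle inequality, up to a constant, follows from a pointwise estimate instead of Minkowski's
  inequality.
\<close>

definition energy :: "real \<Rightarrow> real \<Rightarrow> 'a::euclidean_space set \<Rightarrow> ('a \<Rightarrow> real) \<Rightarrow> ennreal" where
  "energy s p \<Omega> u =
     (\<integral>\<^sup>+ y. (\<integral>\<^sup>+ x.
       ennreal (\<bar>u x - u y\<bar> powr p / norm (x - y) powr (real DIM('a) + s * p)) \<partial>lebesgue) \<partial>lebesgue)
     + (\<integral>\<^sup>+ x \<in> \<Omega>. ennreal (\<bar>u x\<bar> powr p) \<partial>lebesgue)"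

lemma ennroot_less_iff:
  assumes "p > 0" "\<epsilon> > 0"
  shows "ennroot p t < ennreal \<epsilon> \<longleftrightarrow> t < ennreal (\<epsilon> powr p)"
proof (cases t)
  case (real r)
  have "r powr (1 / p) < \<epsilon> \<longleftrightarrow> r < \<epsilon> powr p"
  proof
    assume "r powr (1 / p) < \<epsilon>"
    then have "(r powr (1 / p)) powr p < \<epsilon> powr p"
      using assms by (intro powr_less_mono2) auto
    then show "r < \<epsilon> powr p"
      using real assms by (simp add: powr_powr)
  next
    assume "r < \<epsilon> powr p"
    then have "r powr (1 / p) < (\<epsilon> powr p) powr (1 / p)"
      using assms real by (intro powr_less_mono2) auto
    then show "r powr (1 / p) < \<epsilon>"
      using assms by (simp add: powr_powr)
  qed
  then show ?thesis
    using real assms by (simp add: ennroot_def ennreal_less_iff)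
qed (simp add: ennroot_def)

lemma frac_norm_finite_iff: "frac_norm s p \<Omega> u < \<infinity> \<longleftrightarrow> energy s p \<Omega> u < \<infinity>"
  by (simp add: frac_norm_def gagliardo_seminorm_def Lp_norm_def ennroot_def energy_def less_top)

lemma frac_norm_small_iff_energy_small:
  assumes "p > 0"
  shows "(\<forall>\<epsilon>::real. \<epsilon> > 0 \<longrightarrow> (\<exists>w\<in>W. frac_norm s p \<Omega> w < ennreal \<epsilon>)) \<longleftrightarrow>
    (\<forall>\<epsilon>::real. \<epsilon> > 0 \<longrightarrow> (\<exists>w\<in>W. energy s p \<Omega> w < ennreal \<epsilon>))"
    (is "?N \<longleftrightarrow> ?E")
proof
  have half: "a + b < ennreal \<epsilon>" if "a < ennreal (\<epsilon> / 2)" "b < ennreal (\<epsilon> / 2)" "\<epsilon> > 0" for a b \<epsilon>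
  proof -
    have "a + b < ennreal (\<epsilon> / 2) + ennreal (\<epsilon> / 2)"
      using that by (intro add_strict_mono)
    also have "\<dots> = ennreal \<epsilon>"
      using that by (simp flip: ennreal_plus)
    finally show ?thesis .
  qed
  {
    assume ?N
    show ?E
    proof (intro allI impI)
      fix \<epsilon> :: real assume "\<epsilon> > 0"
      define \<delta> where "\<delta> = (\<epsilon> / 2) powr (1 / p)"
      have \<delta>: "\<delta> > 0" "\<delta> powr p = \<epsilon> / 2"
        using \<open>\<epsilon> > 0\<close> assms by (auto simp: \<delta>_def powr_powr)
      then obtain w where w: "w \<in> W" "frac_norm s p \<Omega> w < ennreal \<delta>"
        using \<open>?N\<close> by blast
      then have "gagliardo_seminorm s p w < ennreal \<delta>" "Lp_norm p \<Omega> w < ennreal \<delta>"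
        unfolding frac_norm_def
        by (meson le_iff_add le_less_trans add.commute add_increasing order_refl zero_le
            add_increasing2)+
      then have "energy s p \<Omega> w < ennreal \<epsilon>"
        unfolding energy_def using \<open>\<epsilon> > 0\<close> \<delta> assms
        by (intro half) (simp_all add: gagliardo_seminorm_def Lp_norm_def ennroot_less_iff)
      then show "\<exists>w\<in>W. energy s p \<Omega> w < ennreal \<epsilon>"
        using w by blast
    qed
  next
    assume ?E
    show ?N
    proof (intro allI impI)
      fix \<epsilon> :: real assume "\<epsilon> > 0"
      then have "(\<epsilon> / 2) powr p > 0" by simp
      then obtain w where w: "w \<in> W" "energy s p \<Omega> w < ennreal ((\<epsilon> / 2) powr p)"
        using \<open>?E\<close> by blast
      have "gagliardo_seminorm s p w < ennreal (\<epsilon> / 2)" "Lp_norm p \<Omega> w < ennreal (\<epsilon> / 2)"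
        unfolding gagliardo_seminorm_def Lp_norm_def using \<open>\<epsilon> > 0\<close> assms w(2)
        by (simp_all add: ennroot_less_iff energy_def)
          (meson le_less_trans add_increasing order_refl zero_le add_increasing2)+
      then have "frac_norm s p \<Omega> w < ennreal \<epsilon>"
        unfolding frac_norm_def using \<open>\<epsilon> > 0\<close> by (intro half)
      then show "\<exists>w\<in>W. frac_norm s p \<Omega> w < ennreal \<epsilon>"
        using w by blast
    qed
  }
qed

lemma W0_iff_energy:
  assumes "p > 0"
  shows "u \<in> W0 s p \<Omega> \<longleftrightarrow> u \<in> borel_measurable lebesgue \<and>
    (AE x in lebesgue. x \<notin> \<Omega> \<longrightarrow> u x = 0) \<and> energy s p \<Omega> u < \<infinity> \<and>
    (\<forall>\<epsilon>::real. \<epsilon> > 0 \<longrightarrow> (\<exists>\<psi>\<in>test_functions \<Omega>. energy s p \<Omega> (\<lambda>x. u x - \<psi> x) < ennreal \<epsilon>))"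
  using frac_norm_small_iff_energy_small[OF assms, of "(\<lambda>\<psi> x. u x - \<psi> x) ` test_functions \<Omega>" s \<Omega>]
  unfolding W0_def mem_Collect_eq frac_norm_finite_iff by simp

lemma measurable_norm_diff_pair [measurable]:
  "(\<lambda>z. norm (fst z - snd z)) \<in> borel_measurable (lebesgue \<Otimes>\<^sub>M (lebesgue :: 'a::euclidean_space measure))"
proof -
  have [measurable]: "(\<lambda>x. x) \<in> lebesgue \<rightarrow>\<^sub>M (borel :: 'a measure)"
    by (simp add: measurable_completion)
  have [measurable]: "fst \<in> lebesgue \<Otimes>\<^sub>M lebesgue \<rightarrow>\<^sub>M (borel :: 'a measure)"
      "snd \<in> lebesgue \<Otimes>\<^sub>M lebesgue \<rightarrow>\<^sub>M (borel :: 'a measure)"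
    by (auto intro: measurable_compose[OF measurable_fst] measurable_compose[OF measurable_snd])
  show ?thesis by measurable
qed

lemma measurable_Gagliardo_quotient [measurable]:
  fixes u :: "'a::euclidean_space \<Rightarrow> real"
  assumes [measurable]: "u \<in> borel_measurable lebesgue"
  shows "(\<lambda>z. \<bar>u (fst z) - u (snd z)\<bar> powr p / norm (fst z - snd z) powr q)
    \<in> borel_measurable (lebesgue \<Otimes>\<^sub>M lebesgue)"
  by measurable

lemma measurable_frac_p_laplacian_integrand:
  fixes u \<eta> :: "'a::euclidean_space \<Rightarrow> real"
  assumes [measurable]: "u \<in> borel_measurable lebesgue" "\<eta> \<in> borel_measurable lebesgue"
  shows "(\<lambda>(x, y). \<bar>u x - u y\<bar> powr (p - 2) * (u x - u y) * (\<eta> x - \<eta> y) / norm (x - y) powr q)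
    \<in> borel_measurable (lebesgue \<Otimes>\<^sub>M lebesgue)"
  unfolding case_prod_beta by measurable

lemma Gagliardo_energy_eq_pair:
  fixes u :: "'a::euclidean_space \<Rightarrow> real"
  assumes "u \<in> borel_measurable lebesgue"
  shows "(\<integral>\<^sup>+ y. (\<integral>\<^sup>+ x. ennreal (\<bar>u x - u y\<bar> powr p / norm (x - y) powr q) \<partial>lebesgue) \<partial>lebesgue) =
    (\<integral>\<^sup>+ z. ennreal (\<bar>u (fst z) - u (snd z)\<bar> powr p / norm (fst z - snd z) powr q) \<partial>(lebesgue \<Otimes>\<^sub>M lebesgue))"
  using assms by (subst lebesgue_pair.nn_integral_snd[symmetric]) auto

lemma abs_diff_powr_le:
  fixes a b p :: real
  assumes "p > 0"
  shows "\<bar>a - b\<bar> powr p \<le> 2 powr p * (\<bar>a\<bar> powr p + \<bar>b\<bar> powr p)"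
proof -
  have "\<bar>a - b\<bar> powr p \<le> (2 * max \<bar>a\<bar> \<bar>b\<bar>) powr p"
    using assms by (intro powr_mono2) auto
  also have "\<dots> = 2 powr p * max \<bar>a\<bar> \<bar>b\<bar> powr p"
    by (simp add: powr_mult)
  also have "\<dots> \<le> 2 powr p * (\<bar>a\<bar> powr p + \<bar>b\<bar> powr p)"
    by (intro mult_left_mono) (auto simp: max_def)
  finally show ?thesis .
qed

lemma energy_diff_le:
  fixes u v :: "'a::euclidean_space \<Rightarrow> real"
  assumes [measurable]: "u \<in> borel_measurable lebesgue" "v \<in> borel_measurable lebesgue" "\<Omega> \<in> sets lebesgue"
    and p: "p > 0"
  shows "energy s p \<Omega> (\<lambda>x. u x - v x) \<le> ennreal (2 powr p) * (energy s p \<Omega> u + energy s p \<Omega> v)"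
proof -
  define q where "q = real DIM('a) + s * p"
  define G where "G w z = \<bar>w (fst z) - w (snd z)\<bar> powr p / norm (fst z - snd z) powr q"
    for w :: "'a \<Rightarrow> real" and z
  have [measurable]: "G w \<in> borel_measurable (lebesgue \<Otimes>\<^sub>M lebesgue)"
    if "w \<in> borel_measurable lebesgue" for w
    using that unfolding G_def by (rule measurable_Gagliardo_quotient)
  have E: "energy s p \<Omega> w = (\<integral>\<^sup>+ z. ennreal (G w z) \<partial>(lebesgue \<Otimes>\<^sub>M lebesgue))
      + (\<integral>\<^sup>+ x \<in> \<Omega>. ennreal (\<bar>w x\<bar> powr p) \<partial>lebesgue)" if "w \<in> borel_measurable lebesgue" for w
    unfolding energy_def G_def q_def[symmetric] Gagliardo_energy_eq_pair[OF that] ..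
  have G0: "G w z \<ge> 0" for w z
    by (simp add: G_def)
  have "G (\<lambda>x. u x - v x) z \<le> 2 powr p * (G u z + G v z)" for z
  proof -
    have "\<bar>(u (fst z) - v (fst z)) - (u (snd z) - v (snd z))\<bar> powr p
        \<le> 2 powr p * (\<bar>u (fst z) - u (snd z)\<bar> powr p + \<bar>v (fst z) - v (snd z)\<bar> powr p)"
      using abs_diff_powr_le[OF p, of "u (fst z) - u (snd z)" "v (fst z) - v (snd z)"]
      by (simp add: algebra_simps)
    from divide_right_mono[OF this, of "norm (fst z - snd z) powr q"] show ?thesis
      by (simp add: G_def add_divide_distrib algebra_simps)
  qed
  then have "(\<integral>\<^sup>+ z. ennreal (G (\<lambda>x. u x - v x) z) \<partial>(lebesgue \<Otimes>\<^sub>M lebesgue))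
      \<le> (\<integral>\<^sup>+ z. ennreal (2 powr p) * (ennreal (G u z) + ennreal (G v z)) \<partial>(lebesgue \<Otimes>\<^sub>M lebesgue))"
    using G0 by (intro nn_integral_mono) (simp flip: ennreal_plus ennreal_mult add: ennreal_leI)
  also have "\<dots> = ennreal (2 powr p) * ((\<integral>\<^sup>+ z. ennreal (G u z) \<partial>(lebesgue \<Otimes>\<^sub>M lebesgue))
      + (\<integral>\<^sup>+ z. ennreal (G v z) \<partial>(lebesgue \<Otimes>\<^sub>M lebesgue)))"
    by (simp add: nn_integral_cmult nn_integral_add)
  finally have 1: "(\<integral>\<^sup>+ z. ennreal (G (\<lambda>x. u x - v x) z) \<partial>(lebesgue \<Otimes>\<^sub>M lebesgue)) \<le> \<dots>" .
  have "(\<integral>\<^sup>+ x \<in> \<Omega>. ennreal (\<bar>u x - v x\<bar> powr p) \<partial>lebesgue)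
      \<le> (\<integral>\<^sup>+ x. ennreal (2 powr p) * (ennreal (\<bar>u x\<bar> powr p) * indicator \<Omega> x
          + ennreal (\<bar>v x\<bar> powr p) * indicator \<Omega> x) \<partial>lebesgue)"
    using abs_diff_powr_le[OF p]
    by (intro nn_integral_mono)
      (auto simp flip: ennreal_plus ennreal_mult simp: ennreal_leI indicator_def)
  also have "\<dots> = ennreal (2 powr p) * ((\<integral>\<^sup>+ x \<in> \<Omega>. ennreal (\<bar>u x\<bar> powr p) \<partial>lebesgue)
      + (\<integral>\<^sup>+ x \<in> \<Omega>. ennreal (\<bar>v x\<bar> powr p) \<partial>lebesgue))"
    by (simp add: nn_integral_cmult nn_integral_add)
  finally have 2: "(\<integral>\<^sup>+ x \<in> \<Omega>. ennreal (\<bar>u x - v x\<bar> powr p) \<partial>lebesgue) \<le> \<dots>" .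
  show ?thesis
    using add_mono[OF 1 2] by (simp add: E distrib_left add_ac)
qed

lemma W0_diff:
  fixes u v :: "'a::euclidean_space \<Rightarrow> real"
  assumes p: "p > 0" and \<Omega>: "\<Omega> \<in> sets lebesgue" and u: "u \<in> W0 s p \<Omega>" and v: "v \<in> W0 s p \<Omega>"
  shows "(\<lambda>x. u x - v x) \<in> W0 s p \<Omega>"
  unfolding W0_iff_energy[OF p]
proof (intro conjI allI impI)
  note u' = u[unfolded W0_iff_energy[OF p]]
  note v' = v[unfolded W0_iff_energy[OF p]]
  have um: "u \<in> borel_measurable lebesgue" and vm: "v \<in> borel_measurable lebesgue"
    using u' v' by auto
  then show "(\<lambda>x. u x - v x) \<in> borel_measurable lebesgue"
    by simp
  have "AE x in lebesgue. x \<notin> \<Omega> \<longrightarrow> u x = 0" "AE x in lebesgue. x \<notin> \<Omega> \<longrightarrow> v x = 0"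
    using u' v' by auto
  then show "AE x in lebesgue. x \<notin> \<Omega> \<longrightarrow> u x - v x = 0"
    by eventually_elim simp
  have "energy s p \<Omega> (\<lambda>x. u x - v x) \<le> ennreal (2 powr p) * (energy s p \<Omega> u + energy s p \<Omega> v)"
    by (rule energy_diff_le[OF um vm \<Omega> p])
  also have "\<dots> < \<infinity>"
    using u' v' by (simp add: ennreal_mult_less_top)
  finally show "energy s p \<Omega> (\<lambda>x. u x - v x) < \<infinity>" .
  fix \<epsilon> :: real assume "\<epsilon> > 0"
  define \<delta> where "\<delta> = \<epsilon> / (2 * 2 powr p)"
  have "\<delta> > 0" using \<open>\<epsilon> > 0\<close> by (simp add: \<delta>_def)
  obtain \<psi> where \<psi>: "\<psi> \<in> test_functions \<Omega>" "energy s p \<Omega> (\<lambda>x. u x - \<psi> x) < ennreal \<delta>"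
    using u' \<open>\<delta> > 0\<close> by blast
  obtain \<xi> where \<xi>: "\<xi> \<in> test_functions \<Omega>" "energy s p \<Omega> (\<lambda>x. v x - \<xi> x) < ennreal \<delta>"
    using v' \<open>\<delta> > 0\<close> by blast
  have "energy s p \<Omega> (\<lambda>x. (u x - v x) - (\<psi> x - \<xi> x)) = energy s p \<Omega> (\<lambda>x. (u x - \<psi> x) - (v x - \<xi> x))"
    by (simp add: algebra_simps)
  also have "\<dots> \<le> ennreal (2 powr p) * (energy s p \<Omega> (\<lambda>x. u x - \<psi> x) + energy s p \<Omega> (\<lambda>x. v x - \<xi> x))"
    using um vm test_functions_measurable[OF \<psi>(1)] test_functions_measurable[OF \<xi>(1)]
    by (intro energy_diff_le \<Omega> p) auto
  also have "\<dots> < ennreal (2 powr p) * (ennreal \<delta> + ennreal \<delta>)"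
    using \<psi>(2) \<xi>(2) by (intro ennreal_mult_strict_left_mono add_strict_mono) auto
  also have "\<dots> = ennreal \<epsilon>"
    using \<open>\<delta> > 0\<close> by (simp flip: ennreal_plus ennreal_mult) (simp add: \<delta>_def)
  finally show "\<exists>\<psi>\<in>test_functions \<Omega>. energy s p \<Omega> (\<lambda>x. u x - v x - \<psi> x) < ennreal \<epsilon>"
    using test_functions_diff[OF \<psi>(1) \<xi>(1)] by (intro bexI[of _ "\<lambda>x. \<psi> x - \<xi> x"])
qed

section \<open>Isometries act on the nonlocal problem\<close>

text \<open>
  One derivative \<open>L\<close> serves all points: isometries are affine, and a constant derivative
  is what keeps test functions smooth under composition by the simple induction above.
\<close>

locale lebesgue_isometry =
  fixes T L :: "'a::euclidean_space \<Rightarrow> 'a"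
  assumes dist_T: "dist (T x) (T y) = dist x y"
    and derivative_T: "(T has_derivative L) (at x)"
    and measurable_T [measurable]: "T \<in> lebesgue \<rightarrow>\<^sub>M lebesgue"
    and distr_T: "distr lebesgue lebesgue T = lebesgue"
begin

lemma nn_integral_compose:
  assumes "f \<in> borel_measurable lebesgue"
  shows "(\<integral>\<^sup>+ x. f (T x) \<partial>lebesgue) = (\<integral>\<^sup>+ x. f x \<partial>lebesgue)"
  using nn_integral_distr[OF measurable_T, of f] assms by (simp add: distr_T)

lemma integral_compose:
  fixes f :: "'a \<Rightarrow> real"
  assumes "f \<in> borel_measurable lebesgue"
  shows "(LINT x|lebesgue. f (T x)) = (LINT x|lebesgue. f x)"
  using integral_distr[OF measurable_T, of f] assms by (simp add: distr_T)

lemma norm_diff: "norm (T x - T y) = norm (x - y)"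
  using dist_T by (simp add: dist_norm)

lemma energy_compose:
  assumes [measurable]: "u \<in> borel_measurable lebesgue" "\<Omega> \<in> sets lebesgue"
    and \<Omega>: "\<And>x. T x \<in> \<Omega> \<longleftrightarrow> x \<in> \<Omega>"
  shows "energy s p \<Omega> (\<lambda>x. u (T x)) = energy s p \<Omega> u"
proof -
  define q where "q = real DIM('a) + s * p"
  define G where "G = (\<lambda>x y. ennreal (\<bar>u x - u y\<bar> powr p / norm (x - y) powr q))"
  have G[measurable]: "case_prod G \<in> borel_measurable (lebesgue \<Otimes>\<^sub>M lebesgue)"
    using measurable_Gagliardo_quotient[of u p q] by (simp add: G_def case_prod_beta)
  have "(\<integral>\<^sup>+ y. \<integral>\<^sup>+ x. G (T x) (T y) \<partial>lebesgue \<partial>lebesgue) = (\<integral>\<^sup>+ y. \<integral>\<^sup>+ x. G x (T y) \<partial>lebesgue \<partial>lebesgue)"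
    by (subst nn_integral_compose[of "\<lambda>x. G x (T y)" for y]) auto
  also have "\<dots> = (\<integral>\<^sup>+ y. \<integral>\<^sup>+ x. G x y \<partial>lebesgue \<partial>lebesgue)"
    by (rule nn_integral_compose[of "\<lambda>y. \<integral>\<^sup>+ x. G x y \<partial>lebesgue"]) measurable
  finally have "(\<integral>\<^sup>+ y. \<integral>\<^sup>+ x. G (T x) (T y) \<partial>lebesgue \<partial>lebesgue) = \<dots>" .
  moreover have "(\<integral>\<^sup>+ x \<in> \<Omega>. ennreal (\<bar>u (T x)\<bar> powr p) \<partial>lebesgue) = (\<integral>\<^sup>+ x \<in> \<Omega>. ennreal (\<bar>u x\<bar> powr p) \<partial>lebesgue)"
    using nn_integral_compose[of "\<lambda>x. ennreal (\<bar>u x\<bar> powr p) * indicator \<Omega> x"] \<Omega>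
    by (simp add: indicator_def)
  ultimately show ?thesis
    by (simp add: energy_def G_def q_def norm_diff)
qed

lemma test_functions_compose:
  assumes \<psi>: "\<psi> \<in> test_functions \<Omega>" and \<Omega>: "\<And>x. T x \<in> \<Omega> \<longleftrightarrow> x \<in> \<Omega>"
  shows "(\<lambda>x. \<psi> (T x)) \<in> test_functions \<Omega>"
proof -
  define K where "K = closure {x. \<psi> x \<noteq> 0}"
  have K: "compact K" "K \<subseteq> \<Omega>"
    using \<psi> by (auto simp: test_functions_def K_def)
  have "continuous_on UNIV T"
    using derivative_T by (meson continuous_at_imp_continuous_on has_derivative_continuous)
  then have "closed (T -` K)"
    using K by (simp add: compact_imp_closed continuous_closed_vimage continuous_on_eq_continuous_at)
  moreover obtain B where B: "\<And>y. y \<in> K \<Longrightarrow> dist (T 0) y \<le> B"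
    using compact_imp_bounded[OF K(1)] bounded_any_center[of K "T 0"] by auto
  have "bounded (T -` K)"
    unfolding bounded_any_center[of _ 0] using B dist_T[of 0] by fastforce
  ultimately have cT: "compact (T -` K)"
    by (simp add: compact_eq_bounded_closed)
  have "{x. \<psi> (T x) \<noteq> 0} \<subseteq> T -` K"
    using closure_subset[of "{x. \<psi> x \<noteq> 0}"] by (auto simp: K_def)
  then have sub: "closure {x. \<psi> (T x) \<noteq> 0} \<subseteq> T -` K"
    using cT by (simp add: closure_minimal compact_imp_closed)
  then have "compact (closure {x. \<psi> (T x) \<noteq> 0})"
    using compact_Int_closed[OF cT closed_closure] by (metis inf.absorb2)
  moreover have "T -` K \<subseteq> \<Omega>"
    using K(2) \<Omega> by auto
  moreover have "C_diff k (\<lambda>x. \<psi> (T x))" for k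
    using \<psi> by (intro C_diff_compose_affine[OF derivative_T]) (simp add: test_functions_def)
  ultimately show ?thesis
    using sub unfolding test_functions_def by blast
qed

lemma W0_compose:
  assumes p: "p > 0" and \<Omega>: "\<Omega> \<in> sets lebesgue" "\<And>x. T x \<in> \<Omega> \<longleftrightarrow> x \<in> \<Omega>" and u: "u \<in> W0 s p \<Omega>"
  shows "(\<lambda>x. u (T x)) \<in> W0 s p \<Omega>"
  unfolding W0_iff_energy[OF p]
proof (intro conjI allI impI)
  note u' = u[unfolded W0_iff_energy[OF p]]
  have um [measurable]: "u \<in> borel_measurable lebesgue"
    using u' by auto
  then show "(\<lambda>x. u (T x)) \<in> borel_measurable lebesgue"
    by measurable
  have "AE x in distr lebesgue lebesgue T. x \<notin> \<Omega> \<longrightarrow> u x = 0"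
    unfolding distr_T using u' by blast
  then have "AE x in lebesgue. T x \<notin> \<Omega> \<longrightarrow> u (T x) = 0"
    by (rule AE_distrD[OF measurable_T])
  then show "AE x in lebesgue. x \<notin> \<Omega> \<longrightarrow> u (T x) = 0"
    by (simp add: \<Omega>)
  show "energy s p \<Omega> (\<lambda>x. u (T x)) < \<infinity>"
    using u' by (simp add: energy_compose \<Omega>)
  fix \<epsilon> :: real assume "\<epsilon> > 0"
  then obtain \<psi> where \<psi>: "\<psi> \<in> test_functions \<Omega>" "energy s p \<Omega> (\<lambda>x. u x - \<psi> x) < ennreal \<epsilon>"
    using u' by blast
  have "energy s p \<Omega> (\<lambda>x. u (T x) - \<psi> (T x)) = energy s p \<Omega> (\<lambda>x. u x - \<psi> x)"
    using test_functions_measurable[OF \<psi>(1)] um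
    by (intro energy_compose[of "\<lambda>x. u x - \<psi> x"] \<Omega>) auto
  then show "\<exists>\<psi>\<in>test_functions \<Omega>. energy s p \<Omega> (\<lambda>x. u (T x) - \<psi> x) < ennreal \<epsilon>"
    using \<psi> test_functions_compose[OF \<psi>(1) \<Omega>(2)] by (intro bexI[of _ "\<lambda>x. \<psi> (T x)"]) auto
qed

lemma frac_p_laplacian_compose:
  assumes [measurable]: "u \<in> borel_measurable lebesgue" "\<eta> \<in> borel_measurable lebesgue"
  shows "frac_p_laplacian s p (\<lambda>x. u (T x)) (\<lambda>x. \<eta> (T x)) = frac_p_laplacian s p u \<eta>"
proof -
  define q where "q = real DIM('a) + s * p"
  define F where "F = (\<lambda>x y. \<bar>u x - u y\<bar> powr (p - 2) * (u x - u y) * (\<eta> x - \<eta> y) / norm (x - y) powr q)"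
  have F [measurable]: "case_prod F \<in> borel_measurable (lebesgue \<Otimes>\<^sub>M lebesgue)"
    unfolding F_def by (rule measurable_frac_p_laplacian_integrand) measurable
  have "(LINT y|lebesgue. LINT x|lebesgue. F (T x) (T y)) = (LINT y|lebesgue. LINT x|lebesgue. F x (T y))"
    by (subst integral_compose[of "\<lambda>x. F x (T y)" for y]) auto
  also have "\<dots> = (LINT y|lebesgue. LINT x|lebesgue. F x y)"
    by (rule integral_compose[of "\<lambda>y. LINT x|lebesgue. F x y"]) measurable
  finally show ?thesis
    by (simp add: frac_p_laplacian_def F_def q_def norm_diff)
qed

text \<open>
  An involution moves from the solution to the test function: testing the reflected function with
  \<open>\<eta>\<close> is the same as testing \<open>u\<close> with the reflected \<open>\<eta>\<close>.
\<close>

lemma is_torsion_function_compose: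
  assumes p: "p > 0" and \<Omega>: "\<Omega> \<in> sets lebesgue" "\<And>x. T x \<in> \<Omega> \<longleftrightarrow> x \<in> \<Omega>"
    and TT: "\<And>x. T (T x) = x" and u: "is_torsion_function s p \<Omega> u"
  shows "is_torsion_function s p \<Omega> (\<lambda>x. u (T x))"
  unfolding is_torsion_function_def
proof (intro conjI ballI)
  have uW: "u \<in> W0 s p \<Omega>" using u by (simp add: is_torsion_function_def)
  then show "(\<lambda>x. u (T x)) \<in> W0 s p \<Omega>"
    by (intro W0_compose p \<Omega>)
  fix \<eta> assume \<eta>: "\<eta> \<in> W0 s p \<Omega>"
  have m[measurable]: "u \<in> borel_measurable lebesgue" "\<eta> \<in> borel_measurable lebesgue"
    using uW \<eta> by (auto simp: W0_def)
  have "frac_p_laplacian s p (\<lambda>x. u (T x)) \<eta> = frac_p_laplacian s p (\<lambda>x. u (T x)) (\<lambda>x. \<eta> (T (T x)))"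
    by (simp add: TT)
  also have "\<dots> = frac_p_laplacian s p u (\<lambda>x. \<eta> (T x))"
    by (rule frac_p_laplacian_compose) measurable
  also have "\<dots> = (LINT x:\<Omega>|lebesgue. \<eta> (T x))"
    using u W0_compose[OF p \<Omega> \<eta>] by (simp add: is_torsion_function_def)
  also have "\<dots> = (LINT x:\<Omega>|lebesgue. \<eta> x)"
    using integral_compose[of "\<lambda>x. indicator \<Omega> x *\<^sub>R \<eta> x"] \<Omega>
    by (simp add: set_lebesgue_integral_def indicator_def)
  finally show "frac_p_laplacian s p (\<lambda>x. u (T x)) \<eta> = (LINT x:\<Omega>|lebesgue. \<eta> x)" .
qed

end

lemma lebesgue_isometry_reflect: "lebesgue_isometry (reflect c v) (reflect 0 v)"
proof
  show "(reflect c v has_derivative reflect 0 v) (at x)" for x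
    unfolding reflect_def by (cases "v = 0") (auto intro!: derivative_eq_intros)
qed (auto simp: dist_reflect distr_lebesgue_reflect measurable_lebesgue_reflect)

section \<open>Uniqueness of the torsion function\<close>

lemma abs_powr_mult_self_mono:
  fixes a b p :: real
  assumes "p > 1" "a < b"
  shows "\<bar>a\<bar> powr (p - 2) * a < \<bar>b\<bar> powr (p - 2) * b"
proof -
  have pos: "\<bar>t\<bar> powr (p - 2) * t = t powr (p - 1)" if "t \<ge> 0" for t :: real
    using that powr_mult_base[of t "p - 2"] by (simp add: mult.commute)
  have neg: "\<bar>t\<bar> powr (p - 2) * t = - ((- t) powr (p - 1))" if "t \<le> 0" for t :: real
    using that powr_mult_base[of "- t" "p - 2"] by (simp add: mult.commute)
  consider "a \<ge> 0" | "b \<le> 0" | "a < 0" "b > 0" by linarith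
  then show ?thesis
  proof cases
    case 1
    then show ?thesis
      using assms pos[of a] pos[of b] powr_less_mono2[of "p - 1" a b] by simp
  next
    case 2
    then show ?thesis
      using assms neg[of a] neg[of b] powr_less_mono2[of "p - 1" "- b" "- a"] by simp
  next
    case 3
    then have "\<bar>a\<bar> powr (p - 2) * a < 0" "\<bar>b\<bar> powr (p - 2) * b > 0"
      by (auto simp: mult_pos_neg)
    then show ?thesis by linarith
  qed
qed

text \<open>
  A crude substitute for Young's inequality.  It makes the integrand of the fractional
  \<open>p\<close>-Laplacian dominated by the two Gagliardo quotients.
\<close>

lemma abs_powr_mult_le:
  fixes a b p :: real
  assumes "p > 1"
  shows "\<bar>\<bar>a\<bar> powr (p - 2) * a * b\<bar> \<le> \<bar>a\<bar> powr p + \<bar>b\<bar> powr p"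
proof -
  define m where "m = max \<bar>a\<bar> \<bar>b\<bar>"
  have "\<bar>\<bar>a\<bar> powr (p - 2) * a * b\<bar> = \<bar>a\<bar> powr (p - 1) * \<bar>b\<bar>"
    using powr_mult_base[of "\<bar>a\<bar>" "p - 2"] by (simp add: abs_mult mult.commute)
  also have "\<dots> \<le> m powr (p - 1) * m"
    using assms by (intro mult_mono powr_mono2) (auto simp: m_def)
  also have "\<dots> = m powr p"
    using powr_mult_base[of m "p - 1"] by (simp add: m_def mult.commute)
  also have "\<dots> \<le> \<bar>a\<bar> powr p + \<bar>b\<bar> powr p"
    by (auto simp: m_def max_def)
  finally show ?thesis .
qed

lemma integrable_Gagliardo_quotient:
  fixes u :: "'a::euclidean_space \<Rightarrow> real"
  assumes p: "p > 0" and u: "u \<in> W0 s p \<Omega>"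
  shows "integrable (lebesgue \<Otimes>\<^sub>M lebesgue)
    (\<lambda>z. \<bar>u (fst z) - u (snd z)\<bar> powr p / norm (fst z - snd z) powr (real DIM('a) + s * p))"
proof (rule integrableI_nonneg)
  have m: "u \<in> borel_measurable lebesgue" and "energy s p \<Omega> u < \<infinity>"
    using u unfolding W0_iff_energy[OF p] by auto
  then show "(\<integral>\<^sup>+ z. ennreal (\<bar>u (fst z) - u (snd z)\<bar> powr p /
      norm (fst z - snd z) powr (real DIM('a) + s * p)) \<partial>(lebesgue \<Otimes>\<^sub>M lebesgue)) < \<infinity>"
    by (simp add: energy_def Gagliardo_energy_eq_pair less_top)
  show "(\<lambda>z. \<bar>u (fst z) - u (snd z)\<bar> powr p / norm (fst z - snd z) powr (real DIM('a) + s * p))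
      \<in> borel_measurable (lebesgue \<Otimes>\<^sub>M lebesgue)"
    using m by (rule measurable_Gagliardo_quotient)
qed simp

text \<open>
  Absolute convergence turns the iterated integral of the definition into an integral over the
  product space, where almost everywhere arguments apply to pairs of points.
\<close>

lemma
  fixes u \<eta> :: "'a::euclidean_space \<Rightarrow> real" and s p :: real
  defines "F \<equiv> (\<lambda>x y. \<bar>u x - u y\<bar> powr (p - 2) * (u x - u y) * (\<eta> x - \<eta> y) /
    norm (x - y) powr (real DIM('a) + s * p))"
  assumes p: "p > 1" and u: "u \<in> W0 s p \<Omega>" and \<eta>: "\<eta> \<in> W0 s p \<Omega>"
  shows integrable_frac_p_laplacian: "integrable (lebesgue \<Otimes>\<^sub>M lebesgue) (case_prod F)"
    and frac_p_laplacian_eq_pair: "frac_p_laplacian s p u \<eta> = (LINT z|(lebesgue \<Otimes>\<^sub>M lebesgue). case_prod F z)"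
proof -
  define q where "q = real DIM('a) + s * p"
  define G where "G w z = \<bar>w (fst z) - w (snd z)\<bar> powr p / norm (fst z - snd z) powr q"
    for w :: "'a \<Rightarrow> real" and z
  have [measurable]: "u \<in> borel_measurable lebesgue" "\<eta> \<in> borel_measurable lebesgue"
    using u \<eta> by (auto simp: W0_def)
  have "integrable (lebesgue \<Otimes>\<^sub>M lebesgue) (\<lambda>z. G u z + G \<eta> z)"
    using integrable_Gagliardo_quotient[OF _ u] integrable_Gagliardo_quotient[OF _ \<eta>] p
    unfolding G_def q_def by (intro Bochner_Integration.integrable_add) auto
  then show int: "integrable (lebesgue \<Otimes>\<^sub>M lebesgue) (case_prod F)"
  proof (rule Bochner_Integration.integrable_bound)
    show "case_prod F \<in> borel_measurable (lebesgue \<Otimes>\<^sub>M lebesgue)"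
      unfolding F_def q_def[symmetric] by (rule measurable_frac_p_laplacian_integrand) measurable
    have "\<bar>F x y\<bar> \<le> G u (x, y) + G \<eta> (x, y)" for x y
      using divide_right_mono[OF abs_powr_mult_le[OF p, of "u x - u y" "\<eta> x - \<eta> y"],
          of "norm (x - y) powr q"]
      by (simp add: F_def G_def q_def add_divide_distrib)
    moreover have "G u z \<ge> 0" "G \<eta> z \<ge> 0" for z
      by (simp_all add: G_def)
    ultimately show "AE z in lebesgue \<Otimes>\<^sub>M lebesgue. norm (case_prod F z) \<le> norm (G u z + G \<eta> z)"
      by (auto intro!: AE_I2)
  qed
  show "frac_p_laplacian s p u \<eta> = (LINT z|(lebesgue \<Otimes>\<^sub>M lebesgue). case_prod F z)"
    using lebesgue_pair.integral_snd[OF int] by (simp add: frac_p_laplacian_def F_def)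
qed

text \<open>
  Strict monotonicity of the operator makes the difference \<open>w\<close> of two solutions constant.
  The complement of \<open>\<Omega>\<close> must not be null, for otherwise nothing forces this constant to be zero.
\<close>

lemma torsion_function_unique:
  fixes u v :: "'a::euclidean_space \<Rightarrow> real"
  assumes p: "p > 1" and \<Omega>: "\<Omega> \<in> sets lebesgue" "\<not> (AE x in lebesgue. x \<in> \<Omega>)"
    and u: "is_torsion_function s p \<Omega> u" and v: "is_torsion_function s p \<Omega> v"
  shows "AE x in lebesgue. u x = v x"
proof -
  define q where "q = real DIM('a) + s * p"
  define w where "w x = u x - v x" for x
  have uW: "u \<in> W0 s p \<Omega>" and vW: "v \<in> W0 s p \<Omega>"
    using u v by (simp_all add: is_torsion_function_def)
  then have wW: "w \<in> W0 s p \<Omega>"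
    unfolding w_def using p \<Omega> by (intro W0_diff) auto
  define F where "F f = (\<lambda>x y. \<bar>f x - f y\<bar> powr (p - 2) * (f x - f y) * (w x - w y) /
    norm (x - y) powr q)" for f
  have iu: "integrable (lebesgue \<Otimes>\<^sub>M lebesgue) (case_prod (F u))"
    and iv: "integrable (lebesgue \<Otimes>\<^sub>M lebesgue) (case_prod (F v))"
    unfolding F_def q_def using integrable_frac_p_laplacian[OF p _ wW] uW vW by auto
  have "(LINT z|(lebesgue \<Otimes>\<^sub>M lebesgue). case_prod (F u) z) = frac_p_laplacian s p u w"
    unfolding F_def q_def using frac_p_laplacian_eq_pair[OF p uW wW] by simp
  also have "\<dots> = frac_p_laplacian s p v w"
    using u v wW by (simp add: is_torsion_function_def)
  also have "\<dots> = (LINT z|(lebesgue \<Otimes>\<^sub>M lebesgue). case_prod (F v) z)"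
    unfolding F_def q_def using frac_p_laplacian_eq_pair[OF p vW wW] by simp
  finally have 0: "(LINT z|(lebesgue \<Otimes>\<^sub>M lebesgue). case_prod (F u) z - case_prod (F v) z) = 0"
    using Bochner_Integration.integral_diff[OF iu iv] by simp
  have pos: "F u x y - F v x y > 0" if "w x \<noteq> w y" for x y
  proof -
    define a where "a = u x - u y"
    define b where "b = v x - v y"
    have "a \<noteq> b" "x \<noteq> y"
      using that by (auto simp: a_def b_def w_def)
    have "(\<bar>a\<bar> powr (p - 2) * a - \<bar>b\<bar> powr (p - 2) * b) * (a - b) > 0"
      using abs_powr_mult_self_mono[OF p, of a b] abs_powr_mult_self_mono[OF p, of b a] \<open>a \<noteq> b\<close>
      by (cases a b rule: linorder_cases) (auto intro: mult_pos_pos mult_neg_neg)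
    moreover have "F u x y - F v x y =
        (\<bar>a\<bar> powr (p - 2) * a - \<bar>b\<bar> powr (p - 2) * b) * (a - b) / norm (x - y) powr q"
    proof -
      have "w x - w y = a - b"
        by (simp add: w_def a_def b_def)
      then show ?thesis
        by (simp add: F_def left_diff_distrib diff_divide_distrib flip: a_def b_def)
    qed
    ultimately show ?thesis
      using \<open>x \<noteq> y\<close> by simp
  qed
  have "F u x y - F v x y \<ge> 0" for x y
    using pos[of x y] by (cases "w x = w y") (auto simp: F_def)
  then have "AE z in lebesgue \<Otimes>\<^sub>M lebesgue. case_prod (F u) z - case_prod (F v) z = 0"
    using integral_nonneg_eq_0_iff_AE[OF Bochner_Integration.integrable_diff[OF iu iv]] 0
    by (simp add: case_prod_beta)
  then have "AE z in lebesgue \<Otimes>\<^sub>M lebesgue. w (fst z) = w (snd z)"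
    by eventually_elim (use pos in \<open>force simp: case_prod_beta\<close>)
  from lebesgue_pair.AE_pair[OF this]
  have "AE x in lebesgue. AE y in lebesgue. w x = w y"
    by simp
  then show ?thesis
  proof eventually_elim
    case (elim x)
    have "AE y in lebesgue. y \<notin> \<Omega> \<longrightarrow> w y = 0"
      using wW by (simp add: W0_def)
    with elim have "AE y in lebesgue. y \<notin> \<Omega> \<longrightarrow> w x = 0"
      by eventually_elim simp
    then have "w x = 0"
      using \<Omega>(2) by (cases "w x = 0") auto
    then show "u x = v x"
      by (simp add: w_def)
  qed
qed

section \<open>Radial symmetry of the torsion function\<close>

theorem corollary2p1:
  fixes c :: "'a::euclidean_space" and r s p :: real and \<phi> :: "'a \<Rightarrow> real"
  assumes "DIM('a) \<ge> 2"
    and "0 < s" and "s < 1" and "1 < p" and "p < real DIM('a) / s"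
    and "0 < r"
    and "is_torsion_function s p (ball c r) \<phi>"
  shows "radial_about c \<phi>"
proof (rule radial_if_AE_reflect_eq)
  show "\<phi> \<in> borel_measurable lebesgue"
    using assms by (simp add: is_torsion_function_def W0_def)
  fix v
  interpret lebesgue_isometry "reflect c v" "reflect 0 v"
    by (rule lebesgue_isometry_reflect)
  have "reflect c v x \<in> ball c r \<longleftrightarrow> x \<in> ball c r" for x
    using dist_T[of c x] by simp
  then have "is_torsion_function s p (ball c r) (\<lambda>x. \<phi> (reflect c v x))"
    using assms by (intro is_torsion_function_compose) auto
  moreover have "\<not> (AE x in lebesgue. x \<in> ball c r)"
  proof
    assume "AE x in lebesgue. x \<in> ball c r"
    then have "emeasure lborel (ball c r) = emeasure lborel (UNIV :: 'a set)"
      by (intro emeasure_eq_AE) (auto simp: AE_completion_iff)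
    then show False
      using emeasure_lborel_ball_finite[of c r] by simp
  qed
  ultimately show "AE x in lebesgue. \<phi> (reflect c v x) = \<phi> x"
    using assms by (intro torsion_function_unique) auto
qed

end
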